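(* Let $K$ be a compact metric space with $\dim_t K>0$. Then for the generic $f\in C(K)$ $$\max_{y\in\mathbb{R}}\dim_H f^{-1}(y)=\dim_{tH}K-1,$$ where in particular the maximum is attained.
   Context: $C(K)$ is the space of continuous functions $K\to\mathbb{R}$ with the supremum metric. "The generic $f\in C(K)$ has property $P$" means that the set of $f\in C(K)$ having $P$ is co-meager (its complement is a countable union of nowhere dense sets). $\dim_H$ is Hausdorff dimension, with the convention $\dim_H\emptyset=-1$. Topological (small inductive) dimension: $\dim_t\emptyset=-1$, and for a non-empty metric space $X$, $\dim_t X=\inf\{d: X$ has a basis $\mathcal{U}$ of open sets such that $\dim_t\partial U\le d-1$ for every $U\in\mathcal{U}\}$. Topological Hausdorff dimension: $\dim_{tH}\emptyset=-1$, and for a non-empty metric space $X$, $\dim_{tH}X=\inf\{d: X$ has a basis $\mathcal{U}$ of open sets such that $\dim_H\partial U\le d-1$ for every $U\in\mathcal{U}\}$. These dimensions may take the value $\infty$ (and $\infty-1=\infty$). *)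

theory Defs
  imports "HOL-Analysis.Analysis"
begin

section \<open>Bases and Baire category in abstract topologies\<close>

text \<open>The analogue of \<^const>\<open>topological_basis\<close> for the type \<^typ>\<open>'a topology\<close>.\<close>

definition basis_of :: "'a topology \<Rightarrow> 'a set set \<Rightarrow> bool" where
  "basis_of X \<B> \<longleftrightarrow>
     (\<forall>U\<in>\<B>. openin X U) \<and> (\<forall>V. openin X V \<longrightarrow> (\<exists>\<B>'. \<B>' \<subseteq> \<B> \<and> \<Union>\<B>' = V))"

definition nowhere_dense_in :: "'a topology \<Rightarrow> 'a set \<Rightarrow> bool" where
  "nowhere_dense_in X A \<longleftrightarrow> A \<subseteq> topspace X \<and> X interior_of (X closure_of A) = {}"

definition meager_in :: "'a topology \<Rightarrow> 'a set \<Rightarrow> bool" where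
  "meager_in X A \<longleftrightarrow> (\<exists>\<F>. countable \<F> \<and> (\<forall>N\<in>\<F>. nowhere_dense_in X N) \<and> A = \<Union>\<F>)"

definition comeager_in :: "'a topology \<Rightarrow> 'a set \<Rightarrow> bool" where
  "comeager_in X A \<longleftrightarrow> A \<subseteq> topspace X \<and> meager_in X (topspace X - A)"


section \<open>The space of continuous real functions on a set\<close>

text \<open>The underlying set consists of the bounded continuous functions on \<open>K\<close> that are
  \<^const>\<open>undefined\<close> outside \<open>K\<close>; the metric is the supremum metric over \<open>K\<close>.\<close>

definition C_space :: "'a::topological_space set \<Rightarrow> ('a \<Rightarrow> real) metric" where
  "C_space K = cfunspace (top_of_set K) euclidean_metric"

lemma mspace_C_space:
  assumes "compact K"
  shows "mspace (C_space K) = {f. continuous_on K f \<and> f \<in> extensional K}"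
proof -
  have "bounded (f ` K)" if "continuous_on K f" for f :: "'a \<Rightarrow> real"
    using assms compact_continuous_image compact_imp_bounded that by blast
  then show ?thesis
    by (auto simp: C_space_def)
qed

lemma mdist_C_space:
  assumes "K \<noteq> {}" "f \<in> mspace (C_space K)" "g \<in> mspace (C_space K)"
  shows "mdist (C_space K) f g = (SUP x\<in>K. dist (f x) (g x))"
proof -
  have fg: "f \<in> Met_TC.fspace K" "g \<in> Met_TC.fspace K"
    using assms by (auto simp: C_space_def Met_TC.fspace_def)
  have "mdist (C_space K) = Met_TC.fdist K"
    by (simp add: C_space_def mdist_cfunspace_eq_mdist_funspace funspace_def
        Metric_space.mdist_metric Met_TC.Metric_space_funspace)
  then show ?thesis
    using assms(1) fg by (simp add: Met_TC.fdist_def)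
qed


section \<open>Hausdorff dimension\<close>

text \<open>The \<open>s\<close>-th power of the diameter, with \<open>0\<^sup>0 = 1\<close> for nonempty sets (whereas
  \<open>0 powr 0 = 0\<close> in the library) and the value \<open>0\<close> for the empty set.\<close>

definition diam_pow :: "real \<Rightarrow> 'a::metric_space set \<Rightarrow> real" where
  "diam_pow s U = (if U = {} then 0 else if s = 0 then 1 else diameter U powr s)"

text \<open>Boundedness is required separately because \<^const>\<open>diameter\<close> is real-valued and hence
  meaningless on unbounded sets.\<close>

definition hausdorff_premeasure :: "real \<Rightarrow> real \<Rightarrow> 'a::metric_space set \<Rightarrow> ennreal" where
  "hausdorff_premeasure s \<delta> A =
     (INF U \<in> {U :: nat \<Rightarrow> 'a set. A \<subseteq> (\<Union>i. U i) \<and> (\<forall>i. bounded (U i) \<and> diameter (U i) \<le> \<delta>)}.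
        \<Sum>i. ennreal (diam_pow s (U i)))"

definition hausdorff_measure :: "real \<Rightarrow> 'a::metric_space set \<Rightarrow> ennreal" where
  "hausdorff_measure s A = (SUP \<delta>\<in>{0<..}. hausdorff_premeasure s \<delta> A)"

definition hausdorff_dim :: "'a::metric_space set \<Rightarrow> ereal" where
  "hausdorff_dim A =
     (if A = {} then -1 else Inf {ereal s |s. 0 \<le> s \<and> hausdorff_measure s A = 0})"


section \<open>Small inductive dimension\<close>

text \<open>The relation \<^const>\<open>dimension_le\<close> is the library's small inductive dimension; the numerical
  value is the least bound. The lemmas \<open>small_ind_dim_empty\<close> and \<open>small_ind_dim_rec\<close> below
  give the usual recursive description in terms of bases.\<close>

definition small_ind_dim :: "'a topology \<Rightarrow> ereal" where
  "small_ind_dim X = Inf {ereal (of_int n) |n. X dim_le n}"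

lemma small_ind_dim_le_iff: "small_ind_dim X \<le> ereal r \<longleftrightarrow> X dim_le \<lfloor>r\<rfloor>"
proof
  assume le: "small_ind_dim X \<le> ereal r"
  show "X dim_le \<lfloor>r\<rfloor>"
  proof (rule ccontr)
    assume not: "\<not> X dim_le \<lfloor>r\<rfloor>"
    have "ereal (of_int (\<lfloor>r\<rfloor> + 1)) \<le> small_ind_dim X"
      unfolding small_ind_dim_def
    proof (rule Inf_greatest)
      fix x assume "x \<in> {ereal (of_int n) |n. X dim_le n}"
      then obtain n where n: "x = ereal (of_int n)" "X dim_le n" by auto
      then have "\<lfloor>r\<rfloor> + 1 \<le> n"
        using not dimension_le_mono[of X n "\<lfloor>r\<rfloor>"] by linarith
      then show "ereal (of_int (\<lfloor>r\<rfloor> + 1)) \<le> x"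
        by (simp only: n ereal_less_eq of_int_le_iff)
    qed
    with le have "ereal (of_int (\<lfloor>r\<rfloor> + 1)) \<le> ereal r"
      by (rule order_trans[rotated])
    then show False by simp linarith
  qed
next
  assume "X dim_le \<lfloor>r\<rfloor>"
  then have "small_ind_dim X \<le> ereal (of_int \<lfloor>r\<rfloor>)"
    unfolding small_ind_dim_def by (intro Inf_lower) auto
  also have "\<dots> \<le> ereal r" by simp
  finally show "small_ind_dim X \<le> ereal r" .
qed

lemma small_ind_dim_ge: "-1 \<le> small_ind_dim X"
  unfolding small_ind_dim_def
proof (rule Inf_greatest)
  fix x assume "x \<in> {ereal (of_int n) |n. X dim_le n}"
  then obtain n where n: "x = ereal (of_int n)" "-1 \<le> n"
    using dimension_le_bound by auto
  then have "ereal (-1) \<le> x"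
    by (metis ereal_less_eq(3) of_int_1 of_int_le_iff of_int_minus)
  then show "-1 \<le> x" by (simp add: one_ereal_def)
qed

lemma small_ind_dim_empty: "small_ind_dim trivial_topology = -1"
proof (rule antisym[OF _ small_ind_dim_ge])
  have fl: "\<lfloor>-1 :: real\<rfloor> = -1"
    by linarith
  have "small_ind_dim (trivial_topology :: 'a topology) \<le> ereal (-1)"
    unfolding small_ind_dim_le_iff fl by simp
  then show "small_ind_dim (trivial_topology :: 'a topology) \<le> -1"
    by (simp add: one_ereal_def)
qed

lemma small_ind_dim_rec:
  assumes "topspace X \<noteq> {}"
  shows "small_ind_dim X =
    Inf {d. \<exists>\<B>. basis_of X \<B> \<and> (\<forall>U\<in>\<B>. small_ind_dim (subtopology X (X frontier_of U)) \<le> d - 1)}"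
    (is "_ = Inf ?D")
proof (rule antisym)
  show "small_ind_dim X \<le> Inf ?D"
  proof (rule Inf_greatest)
    fix d assume "d \<in> ?D"
    then obtain \<B> where B: "basis_of X \<B>"
      and dim: "\<And>U. U \<in> \<B> \<Longrightarrow> small_ind_dim (subtopology X (X frontier_of U)) \<le> d - 1"
      by blast
    have "\<B> \<noteq> {}"
      using B assms unfolding basis_of_def
      by (metis Sup_empty openin_topspace subset_empty)
    then obtain U0 where U0: "U0 \<in> \<B>" by blast
    show "small_ind_dim X \<le> d"
    proof (cases d)
      case (real r)
      have dim': "subtopology X (X frontier_of U) dim_le (\<lfloor>r\<rfloor> - 1)" if "U \<in> \<B>" for U
      proof -
        have "small_ind_dim (subtopology X (X frontier_of U)) \<le> ereal (r - 1)"
          using dim[OF that] real by (simp add: one_ereal_def)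
        then show ?thesis by (simp only: small_ind_dim_le_iff floor_diff_one)
      qed
      have "X dim_le \<lfloor>r\<rfloor>"
      proof (rule dimension_le.intros)
        show "-1 \<le> \<lfloor>r\<rfloor>"
          using dimension_le_bound[OF dim'[OF U0]] by linarith
        fix V a assume V: "openin X V" "a \<in> V"
        then obtain U where "U \<in> \<B>" "a \<in> U" "U \<subseteq> V"
          using B unfolding basis_of_def by (metis UnionE Union_upper subsetD)
        then show "\<exists>U. a \<in> U \<and> U \<subseteq> V \<and> openin X U
            \<and> subtopology X (X frontier_of U) dim_le (\<lfloor>r\<rfloor> - 1)"
          using B dim' unfolding basis_of_def by blast
      qed
      then show ?thesis using real small_ind_dim_le_iff by blast
    next
      case MInf
      then have "(-1::ereal) \<le> -\<infinity>"
        using dim[OF U0] small_ind_dim_ge[of "subtopology X (X frontier_of U0)"]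
        by (simp add: one_ereal_def)
      then show ?thesis by (simp add: one_ereal_def)
    qed simp
  qed
next
  show "Inf ?D \<le> small_ind_dim X"
    unfolding small_ind_dim_def[of X]
  proof (rule Inf_mono, safe)
    fix n assume n: "X dim_le n"
    let ?B = "{U. openin X U \<and> subtopology X (X frontier_of U) dim_le (n - 1)}"
    have "basis_of X ?B"
      unfolding basis_of_def
    proof (intro conjI allI impI)
      fix V assume V: "openin X V"
      have "\<Union>{U \<in> ?B. U \<subseteq> V} = V"
      proof
        show "V \<subseteq> \<Union>{U \<in> ?B. U \<subseteq> V}"
        proof
          fix a assume "a \<in> V"
          with n V obtain U where "a \<in> U" "U \<subseteq> V" "openin X U"
            "subtopology X (X frontier_of U) dim_le (n - 1)"
            using dimension_le.cases by metis
          then show "a \<in> \<Union>{U \<in> ?B. U \<subseteq> V}" by blast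
        qed
      qed blast
      then show "\<exists>\<B>'\<subseteq>?B. \<Union>\<B>' = V"
        by (intro exI[of _ "{U \<in> ?B. U \<subseteq> V}"]) blast
    qed simp
    moreover have "small_ind_dim (subtopology X (X frontier_of U)) \<le> ereal (of_int n) - 1"
      if "U \<in> ?B" for U
    proof -
      have "small_ind_dim (subtopology X (X frontier_of U)) \<le> ereal (of_int (n - 1))"
        using that by (simp only: small_ind_dim_le_iff floor_of_int) simp
      then show ?thesis by (simp add: one_ereal_def)
    qed
    ultimately show "\<exists>a\<in>?D. a \<le> ereal (of_int n)"
      by (intro bexI[of _ "ereal (of_int n)"]) blast+
  qed
qed


section \<open>Topological Hausdorff dimension\<close>

text \<open>\<open>A\<close> carries the subspace metric: open sets and boundaries are relative to \<open>A\<close>.\<close>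

definition top_hausdorff_dim :: "'a::metric_space set \<Rightarrow> ereal" where
  "top_hausdorff_dim A =
     (if A = {} then -1
      else Inf {d. \<exists>\<B>. basis_of (top_of_set A) \<B> \<and>
                       (\<forall>U\<in>\<B>. hausdorff_dim (top_of_set A frontier_of U) \<le> d - 1)})"

end

theory Submission
  imports Defs
begin

text \<open>Write \<open>D\<close> for the topological Hausdorff dimension of \<open>K\<close>.

  Upper bound. For \<open>t > D - 1\<close>, cover \<open>K\<close> by finitely many small basic open sets whose boundaries
  are \<open>t\<close>-null, and cover these boundaries by an open set \<open>W\<close> of small \<open>t\<close>-content. Off \<open>W\<close> the
  atoms generated by the basic sets are clopen and small, so a given function can be replaced there by
  nearby distinct constants and extended to \<open>K\<close> by Tietze's theorem. Each fibre of the result, and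
  of any function close enough to it, lies in \<open>W\<close> together with a single atom.

  Lower bound and attainment. For \<open>0 \<le> s < D - 1\<close>, let \<open>B\<^sub>s\<close> be the set of points without arbitrarily
  small neighbourhoods whose boundary has dimension at most \<open>s\<close>. These sets are nonempty, decrease as
  \<open>s\<close> grows, and have no isolated points, so compactness gives a point \<open>x\<^sub>0\<close> that is an accumulation
  point of all of them. Then generically the fibre through \<open>x\<^sub>0\<close> has dimension at least \<open>D - 1\<close>:
  any \<open>f\<close> can be perturbed near \<open>x\<^sub>0\<close> and near some \<open>x\<^sub>1 \<in> B\<^sub>s\<close> close to \<open>x\<^sub>0\<close> so that, stably, the
  part of \<open>{f < f x\<^sub>0}\<close> in a small ball about \<open>x\<^sub>1\<close> is a neighbourhood of \<open>x\<^sub>1\<close> whose boundary lies in the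
  fibre through \<open>x\<^sub>0\<close>.\<close>

section \<open>Null sets via finite open covers\<close>

text \<open>All sets whose dimension matters here are compact, so finite open covers suffice.\<close>

definition small_cover :: "real \<Rightarrow> real \<Rightarrow> 'a::metric_space set \<Rightarrow> bool" where
  "small_cover t e A \<longleftrightarrow>
     (\<exists>\<U>. finite \<U> \<and> (\<forall>U\<in>\<U>. open U \<and> bounded U) \<and> A \<subseteq> \<Union>\<U> \<and> (\<Sum>U\<in>\<U>. diameter U powr t) < e)"

text \<open>No bound on the diameters is imposed: for \<open>t > 0\<close> a small sum of
  \<open>t\<close>-th powers already makes every diameter small.\<close>

definition fin_null :: "real \<Rightarrow> 'a::metric_space set \<Rightarrow> bool" where
  "fin_null t A \<longleftrightarrow> (\<forall>e>0. small_cover t e A)"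

lemma small_cover_subset: "small_cover t e B \<Longrightarrow> A \<subseteq> B \<Longrightarrow> small_cover t e A"
  unfolding small_cover_def by (elim exE) (intro exI, blast)

lemma fin_null_subset: "fin_null t B \<Longrightarrow> A \<subseteq> B \<Longrightarrow> fin_null t A"
  unfolding fin_null_def by (auto intro: small_cover_subset)

lemma small_cover_Un:
  assumes "small_cover t d A" "small_cover t e B"
  shows "small_cover t (d + e) (A \<union> B)"
proof -
  obtain \<U> where U: "finite \<U>" "\<forall>U\<in>\<U>. open U \<and> bounded U" "A \<subseteq> \<Union>\<U>" "(\<Sum>U\<in>\<U>. diameter U powr t) < d"
    using assms(1) unfolding small_cover_def by blast
  obtain \<V> where V: "finite \<V>" "\<forall>U\<in>\<V>. open U \<and> bounded U" "B \<subseteq> \<Union>\<V>" "(\<Sum>U\<in>\<V>. diameter U powr t) < e"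
    using assms(2) unfolding small_cover_def by blast
  have "(\<Sum>U\<in>\<U> \<union> \<V>. diameter U powr t) \<le> (\<Sum>U\<in>\<U>. diameter U powr t) + (\<Sum>U\<in>\<V>. diameter U powr t)"
    using sum.union_inter[OF U(1) V(1), of "\<lambda>U. diameter U powr t"] sum_nonneg[of "\<U> \<inter> \<V>" "\<lambda>U. diameter U powr t"]
    by simp
  then show ?thesis
    unfolding small_cover_def using U V by (intro exI[of _ "\<U> \<union> \<V>"]) (auto; linarith)
qed

lemma fin_null_empty: "fin_null t {}"
  unfolding fin_null_def small_cover_def by (intro allI impI exI[of _ "{}"]) simp

lemma fin_null_Un:
  assumes "fin_null t A" "fin_null t B"
  shows "fin_null t (A \<union> B)"
  unfolding fin_null_def
proof (intro allI impI)
  fix e :: real assume "e > 0"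
  then have "small_cover t (e/2 + e/2) (A \<union> B)"
    using assms unfolding fin_null_def by (intro small_cover_Un) auto
  then show "small_cover t e (A \<union> B)" by simp
qed

lemma fin_null_UN:
  assumes "finite I" "\<And>i. i \<in> I \<Longrightarrow> fin_null t (A i)"
  shows "fin_null t (\<Union>i\<in>I. A i)"
  using assms by (induction I) (simp_all add: fin_null_empty fin_null_Un)

section \<open>Open thickenings of bounded sets\<close>

lemma diameter_le_dist:
  fixes S :: "'a::metric_space set"
  assumes "\<And>x y. x \<in> S \<Longrightarrow> y \<in> S \<Longrightarrow> dist x y \<le> d" "0 \<le> d"
  shows "diameter S \<le> d"
  using assms by (auto simp: diameter_def intro: cSUP_least)

lemma open_superset_diameter:
  fixes A :: "'a::metric_space set"
  assumes "bounded A" "r > 0"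
  obtains V where "open V" "bounded V" "A \<subseteq> V" "diameter V \<le> diameter A + r"
proof
  let ?V = "\<Union>x\<in>A. ball x (r/2)"
  show "open ?V" by auto
  show "A \<subseteq> ?V" using assms by auto
  have d: "dist y z \<le> diameter A + r" if yz: "y \<in> ?V" "z \<in> ?V" for y z
  proof -
    obtain a b where "a \<in> A" "b \<in> A" "y \<in> ball a (r/2)" "z \<in> ball b (r/2)"
      using yz by blast
    then have ab: "a \<in> A" "b \<in> A" "dist a y < r/2" "dist b z < r/2"
      unfolding mem_ball by auto
    have "dist y z \<le> dist a y + dist a b + dist b z"
      using dist_triangle[of y z a] dist_triangle[of a z b] by (simp add: dist_commute)
    then show ?thesis
      using ab diameter_bounded_bound[OF assms(1) ab(1,2)] by linarith
  qed
  show "bounded ?V"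
    unfolding bounded_two_points using d by blast
  show "diameter ?V \<le> diameter A + r"
    using d assms diameter_ge_0[OF assms(1)] by (intro diameter_le_dist) auto
qed

text \<open>Because \<open>t > 0\<close>, \<open>(diameter A + r) powr t\<close> tends to
  \<open>diameter A powr t\<close> as \<open>r\<close> decreases to 0, even when \<open>A\<close>
  has diameter 0.\<close>

lemma open_superset_powr:
  fixes A :: "'a::metric_space set"
  assumes "bounded A" "t > 0" "e > 0"
  obtains V where "open V" "bounded V" "A \<subseteq> V" "diameter V powr t \<le> diameter A powr t + e"
proof -
  have "((\<lambda>r. (diameter A + r) powr t) \<longlongrightarrow> (diameter A + 0) powr t) (at_right 0)"
    using assms diameter_ge_0[OF assms(1)]
    by (intro tendsto_powr2 tendsto_intros) (auto simp: eventually_at_right_less 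
        intro: eventually_mono[OF eventually_at_right_less])
  then have "eventually (\<lambda>r. (diameter A + r) powr t < diameter A powr t + e) (at_right 0)"
    using assms by (intro order_tendstoD(2)) auto
  then have "eventually (\<lambda>r. (diameter A + r) powr t < diameter A powr t + e \<and> r > 0) (at_right 0)"
    by (intro eventually_conj eventually_at_right_less)
  then obtain r where r: "r > 0" "(diameter A + r) powr t < diameter A powr t + e"
    using eventually_happens' trivial_limit_at_right_real by (metis (mono_tags, lifting))
  obtain V where V: "open V" "bounded V" "A \<subseteq> V" "diameter V \<le> diameter A + r"
    using open_superset_diameter[OF assms(1) r(1)] by blast
  have "diameter V powr t \<le> (diameter A + r) powr t"
    using V assms by (intro powr_mono2 diameter_ge_0) auto
  then show ?thesis using that V r by fastforce
qed

section \<open>Finite open covers versus Hausdorff measure and dimension\<close>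

lemma diam_pow_eq_powr: "t > 0 \<Longrightarrow> diam_pow t U = diameter U powr t"
  by (simp add: diam_pow_def)

text \<open>Thickening a countable cover to open sets costs at most \<open>e/2\<close> in total;
  compactness then leaves finitely many of them. The scale 1 suffices for the initial cover.\<close>

lemma hausdorff_null_imp_fin_null:
  fixes A :: "'a::metric_space set"
  assumes "hausdorff_measure t A = 0" "compact A" "t > 0"
  shows "fin_null t A"
  unfolding fin_null_def
proof (intro allI impI)
  fix e :: real assume e: "e > 0"
  have "hausdorff_premeasure t 1 A \<le> hausdorff_measure t A"
    unfolding hausdorff_measure_def by (rule SUP_upper) simp
  then have "hausdorff_premeasure t 1 A < ennreal (e/2)"
    using assms e by (simp add: ennreal_zero_less_divide)
  then obtain U :: "nat \<Rightarrow> 'a set" where U: "A \<subseteq> (\<Union>i. U i)" "\<And>i. bounded (U i)"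
      "(\<Sum>i. ennreal (diam_pow t (U i))) < ennreal (e/2)"
    unfolding hausdorff_premeasure_def Inf_less_iff by auto
  have "\<exists>V. open V \<and> bounded V \<and> U i \<subseteq> V \<and> diameter V powr t \<le> diameter (U i) powr t + (e/2) * (1/2)^(Suc i)" for i
    by (rule open_superset_powr[of "U i" t "(e/2) * (1/2)^(Suc i)"]) (use U e assms in auto)
  then obtain V where V: "\<And>i. open (V i)" "\<And>i. bounded (V i)" "\<And>i. U i \<subseteq> V i"
      "\<And>i. diameter (V i) powr t \<le> diameter (U i) powr t + (e/2) * (1/2)^(Suc i)"
    by metis
  have "A \<subseteq> (\<Union>i\<in>UNIV. V i)" using U(1) V(3) by blast
  then obtain J where J: "finite J" "A \<subseteq> (\<Union>i\<in>J. V i)"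
    using compactE_image[OF assms(2), of UNIV V] V(1) by (metis)
  have "ennreal (\<Sum>i\<in>J. diameter (U i) powr t) = (\<Sum>i\<in>J. ennreal (diam_pow t (U i)))"
    using assms by (simp add: diam_pow_eq_powr)
  also have "\<dots> \<le> (\<Sum>i. ennreal (diam_pow t (U i)))"
    using J by (intro sum_le_suminf) auto
  finally have "ennreal (\<Sum>i\<in>J. diameter (U i) powr t) < ennreal (e/2)"
    using U(3) by (rule le_less_trans)
  then have 1: "(\<Sum>i\<in>J. diameter (U i) powr t) < e/2"
    using e by (simp add: ennreal_less_iff sum_nonneg)
  have "(\<Sum>i\<in>J. (1/2::real)^(Suc i)) \<le> (\<Sum>i. (1/2)^(Suc i))"
    using J power_half_series by (intro sum_le_suminf) (auto simp: sums_iff)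
  also have "\<dots> = 1" using power_half_series by (simp add: sums_iff)
  finally have "(e/2) * (\<Sum>i\<in>J. (1/2::real)^(Suc i)) \<le> e/2"
    using e by simp
  then have 2: "(\<Sum>i\<in>J. (e/2) * (1/2::real)^(Suc i)) \<le> e/2"
    by (simp only: sum_distrib_left)
  \<comment> \<open>Equal sets \<open>V i\<close> merge in the image, so the sum can only
    drop.\<close>
  have "(\<Sum>W\<in>V ` J. diameter W powr t) \<le> (\<Sum>i\<in>J. diameter (V i) powr t)"
    using J by (intro sum_image_le[of J "\<lambda>W. diameter W powr t" V, unfolded comp_def]) auto
  also have "\<dots> \<le> (\<Sum>i\<in>J. diameter (U i) powr t + (e/2) * (1/2)^(Suc i))"
    using V(4) by (intro sum_mono)
  also have "\<dots> < e"
    by (subst sum.distrib) (use 1 2 in linarith)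
  finally show "small_cover t e A"
    unfolding small_cover_def using J V by (intro exI[of _ "V ` J"]) auto
qed

lemma fin_null_imp_hausdorff_null:
  fixes A :: "'a::metric_space set"
  assumes "fin_null t A" "t > 0"
  shows "hausdorff_measure t A = 0"
proof -
  have bound: "hausdorff_premeasure t \<delta> A \<le> ennreal e" if "\<delta> > 0" "e > 0" for \<delta> e
  proof -
    \<comment> \<open>A sum below \<open>\<delta> powr t\<close> forces each member to have diameter
      at most \<open>\<delta>\<close>, so the cover is admissible at scale
      \<open>\<delta>\<close>.\<close>
    have "min e (\<delta> powr t) > 0" using that by simp
    then obtain \<U> where U: "finite \<U>" "\<forall>U\<in>\<U>. open U \<and> bounded U" "A \<subseteq> \<Union>\<U>"
        "(\<Sum>U\<in>\<U>. diameter U powr t) < min e (\<delta> powr t)"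
      using assms unfolding fin_null_def small_cover_def by meson
    obtain h where h: "bij_betw h {..<card \<U>} \<U>"
      using U(1) by (metis bij_betw_from_nat_into_finite)
    \<comment> \<open>Padding with empty sets, on which \<open>diam_pow\<close> vanishes, turns the
      finite family into a sequence.\<close>
    define V where "V i = (if i < card \<U> then h i else {})" for i
    have hU: "h i \<in> \<U>" if "i < card \<U>" for i
      using h that by (auto simp: bij_betw_def)
    have "diameter W \<le> \<delta>" if "W \<in> \<U>" for W
    proof (rule ccontr)
      assume "\<not> diameter W \<le> \<delta>"
      then have "\<delta> powr t \<le> diameter W powr t"
        using assms \<open>\<delta> > 0\<close> by (intro powr_mono2) auto
      also have "\<dots> \<le> (\<Sum>U\<in>\<U>. diameter U powr t)"
        using that U(1) by (intro member_le_sum) auto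
      finally show False using U(4) by simp
    qed
    then have V: "bounded (V i) \<and> diameter (V i) \<le> \<delta>" for i
      using hU[of i] U(2) \<open>\<delta> > 0\<close> by (auto simp: V_def)
    have "(\<Sum>i. ennreal (diam_pow t (V i))) = (\<Sum>i<card \<U>. ennreal (diam_pow t (V i)))"
      by (rule suminf_finite) (auto simp: V_def diam_pow_def)
    also have "\<dots> = ennreal (\<Sum>i<card \<U>. diameter (h i) powr t)"
      using assms by (simp add: diam_pow_eq_powr V_def)
    also have "(\<Sum>i<card \<U>. diameter (h i) powr t) = (\<Sum>U\<in>\<U>. diameter U powr t)"
      using h by (rule sum.reindex_bij_betw)
    finally have "(\<Sum>i. ennreal (diam_pow t (V i))) \<le> ennreal e"
      using U(4) by (simp add: ennreal_leI)
    moreover have "\<Union>\<U> \<subseteq> (\<Union>i. V i)"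
      using h by (force simp: V_def bij_betw_def)
    ultimately show ?thesis
      unfolding hausdorff_premeasure_def using V U(3)
      by (intro INF_lower2[of V]) auto
  qed
  have "hausdorff_premeasure t \<delta> A \<le> 0" if "\<delta> > 0" for \<delta>
    by (rule ennreal_le_epsilon) (use bound that in auto)
  then have "hausdorff_measure t A \<le> 0"
    unfolding hausdorff_measure_def by (intro SUP_least) simp
  then show ?thesis by simp
qed

text \<open>A sum below 1 forces all diameters to be at most 1, and there a larger exponent gives a
  smaller power.\<close>

lemma fin_null_mono:
  fixes A :: "'a::metric_space set"
  assumes "fin_null s A" "0 < s" "s \<le> t"
  shows "fin_null t A"
  unfolding fin_null_def
proof (intro allI impI)
  fix e :: real assume "e > 0"
  then have "small_cover s (min e 1) A" using assms(1) unfolding fin_null_def by simp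
  then obtain \<U> where U: "finite \<U>" "\<forall>U\<in>\<U>. open U \<and> bounded U" "A \<subseteq> \<Union>\<U>"
      "(\<Sum>U\<in>\<U>. diameter U powr s) < min e 1"
    unfolding small_cover_def by auto
  have "diameter U powr t \<le> diameter U powr s" if "U \<in> \<U>" for U
  proof -
    have "diameter U powr s \<le> (\<Sum>U\<in>\<U>. diameter U powr s)"
      using that U(1) by (intro member_le_sum) auto
    then have "diameter U powr s < 1" using U(4) by linarith
    then have "diameter U \<le> 1"
      using assms(2) ge_one_powr_ge_zero[of "diameter U" s] by force
    then show ?thesis
      using assms(3) U(2) that by (intro powr_mono') (auto intro: diameter_ge_0)
  qed
  then have "(\<Sum>U\<in>\<U>. diameter U powr t) \<le> (\<Sum>U\<in>\<U>. diameter U powr s)"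
    by (rule sum_mono)
  then show "small_cover t e A"
    unfolding small_cover_def using U by (intro exI[of _ \<U>]) auto
qed

text \<open>At exponent 0 every nonempty set, even a singleton, contributes 1, so a sum below 1
  leaves only empty sets.\<close>

lemma hausdorff_zero_null_imp_empty:
  fixes A :: "'a::metric_space set"
  assumes "hausdorff_measure 0 A = 0"
  shows "A = {}"
proof -
  have "hausdorff_premeasure 0 1 A \<le> hausdorff_measure 0 A"
    unfolding hausdorff_measure_def by (rule SUP_upper) simp
  then have "hausdorff_premeasure 0 1 A < 1"
    using assms by simp
  then obtain U :: "nat \<Rightarrow> 'a set" where U: "A \<subseteq> (\<Union>i. U i)"
      "(\<Sum>i. ennreal (diam_pow 0 (U i))) < 1"
    unfolding hausdorff_premeasure_def Inf_less_iff by auto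
  have "U i = {}" for i
  proof (rule ccontr)
    assume "U i \<noteq> {}"
    then have "1 = (\<Sum>i\<in>{i}. ennreal (diam_pow 0 (U i)))" by (simp add: diam_pow_def)
    also have "\<dots> \<le> (\<Sum>i. ennreal (diam_pow 0 (U i)))" by (intro sum_le_suminf) auto
    finally show False using U(2) by simp
  qed
  then show ?thesis using U(1) by simp
qed

lemma hausdorff_dim_nonneg: "A \<noteq> {} \<Longrightarrow> 0 \<le> hausdorff_dim A"
  unfolding hausdorff_dim_def by (auto intro!: Inf_greatest)

lemma hausdorff_dim_less_imp_fin_null:
  fixes A :: "'a::metric_space set"
  assumes "hausdorff_dim A < ereal t" "compact A"
  shows "fin_null t A"
proof (cases "A = {}")
  case False
  then have "Inf {ereal s |s. 0 \<le> s \<and> hausdorff_measure s A = 0} < ereal t"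
    using assms by (simp add: hausdorff_dim_def)
  then obtain s where s: "0 \<le> s" "hausdorff_measure s A = 0" "s < t"
    unfolding Inf_less_iff by auto
  then have "s > 0"
    using hausdorff_zero_null_imp_empty[of A] False by (cases "s = 0") auto
  then show ?thesis
    using hausdorff_null_imp_fin_null[OF s(2) assms(2)] s(3) fin_null_mono by fastforce
qed (simp add: fin_null_empty)

text \<open>All exponents above \<open>s\<close> are needed on the right, since the infimum defining
  the dimension need not be attained by a null exponent.\<close>

lemma hausdorff_dim_le_iff:
  fixes A :: "'a::metric_space set"
  assumes "compact A" "s \<ge> 0"
  shows "hausdorff_dim A \<le> ereal s \<longleftrightarrow> (\<forall>t>s. fin_null t A)"
proof
  assume "hausdorff_dim A \<le> ereal s"
  then show "\<forall>t>s. fin_null t A"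
    using assms hausdorff_dim_less_imp_fin_null
    by (metis ereal_less_eq(3) le_less_trans less_ereal.simps(1))
next
  assume *: "\<forall>t>s. fin_null t A"
  show "hausdorff_dim A \<le> ereal s"
  proof (cases "A = {}")
    case True
    then show ?thesis using assms(2) by (simp add: hausdorff_dim_def one_ereal_def)
  next
    case False
    have *: "hausdorff_dim A \<le> ereal t" if "t > s" for t
      using False assms(2) fin_null_imp_hausdorff_null[of t A] * that
      by (auto simp: hausdorff_dim_def intro!: Inf_lower)
    show ?thesis
      by (rule ereal_le_epsilon2) (simp add: *)
  qed
qed

lemma hausdorff_dim_mono:
  fixes A :: "'a::metric_space set"
  assumes "A \<subseteq> B" "compact A" "compact B" "hausdorff_dim B \<le> ereal s" "s \<ge> 0"
  shows "hausdorff_dim A \<le> ereal s"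
  using assms(4) fin_null_subset[OF _ assms(1)]
  by (simp add: hausdorff_dim_le_iff[OF assms(2,5)] hausdorff_dim_le_iff[OF assms(3,5)])

lemma hausdorff_dim_UN:
  assumes "finite I" "\<And>i. i \<in> I \<Longrightarrow> compact (A i)"
    "\<And>i. i \<in> I \<Longrightarrow> hausdorff_dim (A i) \<le> ereal s" "s \<ge> 0"
  shows "hausdorff_dim (\<Union>i\<in>I. A i) \<le> ereal s"
proof -
  have "\<forall>t>s. fin_null t (\<Union>i\<in>I. A i)"
    using assms by (intro allI impI fin_null_UN) (auto simp: hausdorff_dim_le_iff)
  then show ?thesis
    using assms by (simp add: hausdorff_dim_le_iff compact_UN)
qed

section \<open>Category in the space of continuous functions\<close>

lemma mdist_C_space_le:
  assumes "K \<noteq> {}" "f \<in> mspace (C_space K)" "g \<in> mspace (C_space K)"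
    "\<And>x. x \<in> K \<Longrightarrow> \<bar>f x - g x\<bar> \<le> r"
  shows "mdist (C_space K) f g \<le> r"
  using assms by (auto simp: mdist_C_space dist_real_def intro: cSUP_least)

lemma le_mdist_C_space:
  assumes "compact K" "f \<in> mspace (C_space K)" "g \<in> mspace (C_space K)" "x \<in> K"
  shows "\<bar>f x - g x\<bar> \<le> mdist (C_space K) f g"
proof -
  have "continuous_on K (\<lambda>x. dist (f x) (g x))"
    using assms by (intro continuous_intros) (auto simp: mspace_C_space)
  then have "bdd_above ((\<lambda>x. dist (f x) (g x)) ` K)"
    using assms(1) by (intro bounded_imp_bdd_above compact_imp_bounded compact_continuous_image)
  then show ?thesis
    using assms(4) by (subst mdist_C_space[OF _ assms(2,3)]) (auto simp: dist_real_def intro: cSUP_upper2)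
qed

text \<open>Reduces category to perturbation: the perturbed function has a ball of radius
  \<open>\<kappa>\<close> free of \<open>N\<close>, hence lies outside the closure of
  \<open>N\<close>, so that closure contains no ball.\<close>

lemma nowhere_dense_in_C_space:
  fixes K :: "'a::metric_space set"
  assumes K: "compact K" "K \<noteq> {}" and N: "N \<subseteq> mspace (C_space K)"
    and perturb: "\<And>f0 r. continuous_on K f0 \<Longrightarrow> r > 0 \<Longrightarrow>
      \<exists>f \<kappa>. continuous_on K f \<and> \<kappa> > 0 \<and> (\<forall>x\<in>K. \<bar>f0 x - f x\<bar> \<le> r) \<and>
            (\<forall>g\<in>N. \<exists>x\<in>K. \<bar>f x - g x\<bar> \<ge> \<kappa>)"
  shows "nowhere_dense_in (mtopology_of (C_space K)) N"
proof -
  interpret M: Metric_space "mspace (C_space K)" "mdist (C_space K)"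
    by (rule Metric_space_mspace_mdist)
  let ?X = "M.mtopology"
  have "?X interior_of (?X closure_of N) = {}"
  proof (rule ccontr)
    assume "?X interior_of (?X closure_of N) \<noteq> {}"
    then obtain f0 where f0: "f0 \<in> ?X interior_of (?X closure_of N)" by blast
    moreover have "openin ?X (?X interior_of (?X closure_of N))" by simp
    ultimately obtain r where r: "r > 0" "M.mball f0 r \<subseteq> ?X interior_of (?X closure_of N)"
      unfolding M.openin_mtopology by blast
    have f0M: "f0 \<in> mspace (C_space K)"
      using f0 interior_of_subset_topspace M.topspace_mtopology by fastforce
    then have "continuous_on K f0" using K by (simp add: mspace_C_space)
    \<comment> \<open>Half the radius turns the non-strict bound into membership in the open
      ball.\<close>
    then obtain f \<kappa> where f: "continuous_on K f" "\<kappa> > 0" "\<And>x. x \<in> K \<Longrightarrow> \<bar>f0 x - f x\<bar> \<le> r/2"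
        "\<And>g. g \<in> N \<Longrightarrow> \<exists>x\<in>K. \<bar>f x - g x\<bar> \<ge> \<kappa>"
      using perturb[of f0 "r/2"] r(1) by auto
    \<comment> \<open>Members of the function space are \<open>undefined\<close> off
      \<open>K\<close>.\<close>
    define h where "h = restrict f K"
    have h: "h \<in> mspace (C_space K)"
      using f(1) K by (auto simp: mspace_C_space h_def cong: continuous_on_cong)
    have "mdist (C_space K) f0 h \<le> r/2"
      using f(3) by (intro mdist_C_space_le[OF K(2) f0M h]) (simp add: h_def)
    then have "h \<in> M.mball f0 r"
      using f0M h r(1) by simp
    then have "h \<in> ?X closure_of N"
      using r(2) interior_of_subset[of ?X "?X closure_of N"] by (meson subsetD)
    then obtain g where g: "g \<in> N" "mdist (C_space K) h g < \<kappa>"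
      using f(2) unfolding M.metric_closure_of by auto
    obtain x where "x \<in> K" "\<bar>f x - g x\<bar> \<ge> \<kappa>" using f(4)[OF g(1)] by blast
    then show False
      using le_mdist_C_space[OF K(1) h, of g x] g N by (auto simp: h_def)
  qed
  then show ?thesis
    unfolding nowhere_dense_in_def mtopology_of_def using N by simp
qed

text \<open>A meager set must equal the union of its nowhere dense pieces, so each piece is trimmed
  to the complement of \<open>A\<close>.\<close>

lemma comeager_in_superset:
  assumes "countable \<F>" "\<And>N. N \<in> \<F> \<Longrightarrow> nowhere_dense_in X N"
    and "A \<subseteq> topspace X" "topspace X - \<Union>\<F> \<subseteq> A"
  shows "comeager_in X A"
proof -
  let ?\<G> = "(\<lambda>N. N - A) ` \<F>"
  have "nowhere_dense_in X (N - A)" if "N \<in> \<F>" for N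
    using assms(2)[OF that] closure_of_mono[of "N - A" N X] interior_of_mono
    unfolding nowhere_dense_in_def by (metis Diff_subset order_trans subset_empty)
  moreover have "topspace X - A = \<Union>?\<G>"
    using assms(2,4) by (auto simp: nowhere_dense_in_def)
  ultimately show ?thesis
    unfolding comeager_in_def meager_in_def using assms(1,3)
    by (intro conjI exI[of _ ?\<G>] countable_image) auto
qed

section \<open>Small boundaries\<close>

text \<open>The pointwise form of the condition on bases in \<open>top_hausdorff_dim\<close>; it
  makes the set of points where the condition fails available.\<close>

definition small_boundary_at :: "'a::metric_space set \<Rightarrow> ereal \<Rightarrow> 'a \<Rightarrow> bool" where
  "small_boundary_at K s x \<longleftrightarrow>
     (\<forall>r>0. \<exists>U. openin (top_of_set K) U \<and> x \<in> U \<and> U \<subseteq> ball x r \<and>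
        hausdorff_dim (top_of_set K frontier_of U) \<le> s)"

lemma small_boundary_at_mono: "small_boundary_at K s x \<Longrightarrow> s \<le> t \<Longrightarrow> small_boundary_at K t x"
  unfolding small_boundary_at_def by (meson order_trans)

lemma compact_frontier_of:
  assumes "compact K"
  shows "compact (top_of_set K frontier_of U)"
  using closedin_compact[OF assms] closedin_frontier_of by blast

lemma compact_fibre:
  fixes g :: "'a::metric_space \<Rightarrow> real"
  assumes "compact K" "continuous_on K g"
  shows "compact {z \<in> K. g z = y}"
  using continuous_closedin_preimage_constant[OF assms(2)] closedin_compact[OF assms(1)] by blast

lemma basis_imp_small_boundary_at:
  fixes K :: "'a::metric_space set"
  assumes \<B>: "basis_of (top_of_set K) \<B>" "\<And>U. U \<in> \<B> \<Longrightarrow> hausdorff_dim (top_of_set K frontier_of U) \<le> s"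
    and x: "x \<in> K"
  shows "small_boundary_at K s x"
  unfolding small_boundary_at_def
proof (intro allI impI)
  fix r :: real assume "r > 0"
  have "openin (top_of_set K) (K \<inter> ball x r)" by (simp add: openin_open_Int)
  then obtain \<B>' where b: "\<B>' \<subseteq> \<B>" "\<Union>\<B>' = K \<inter> ball x r"
    using \<B>(1) unfolding basis_of_def by metis
  moreover have "x \<in> K \<inter> ball x r" using x \<open>r > 0\<close> by simp
  ultimately obtain U where U: "U \<in> \<B>'" "x \<in> U" by blast
  then have "U \<in> \<B>" "U \<subseteq> ball x r" using b by auto
  then show "\<exists>U. openin (top_of_set K) U \<and> x \<in> U \<and> U \<subseteq> ball x r \<and> hausdorff_dim (top_of_set K frontier_of U) \<le> s"
    using U \<B> unfolding basis_of_def by blast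
qed

lemma small_boundary_at_imp_basis:
  fixes K :: "'a::metric_space set"
  assumes "\<And>x. x \<in> K \<Longrightarrow> small_boundary_at K s x"
  shows "basis_of (top_of_set K) {U. openin (top_of_set K) U \<and> hausdorff_dim (top_of_set K frontier_of U) \<le> s}"
    (is "basis_of _ ?B")
  unfolding basis_of_def
proof (intro conjI allI impI)
  fix V assume V: "openin (top_of_set K) V"
  have "\<exists>U\<in>?B. x \<in> U \<and> U \<subseteq> V" if x: "x \<in> V" for x
  proof -
    have xK: "x \<in> K" using V x openin_imp_subset by blast
    obtain r where r: "r > 0" "ball x r \<inter> K \<subseteq> V"
      using V x unfolding openin_contains_ball by blast
    obtain U where U: "openin (top_of_set K) U" "x \<in> U" "U \<subseteq> ball x r"
        "hausdorff_dim (top_of_set K frontier_of U) \<le> s"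
      using assms[OF xK] r(1) unfolding small_boundary_at_def by blast
    then have "U \<subseteq> V" using r(2) openin_imp_subset[OF U(1)] by blast
    then show ?thesis using U by blast
  qed
  then have "\<Union>{U \<in> ?B. U \<subseteq> V} = V" by blast
  then show "\<exists>\<B>'\<subseteq>?B. \<Union>\<B>' = V" by (intro exI[of _ "{U \<in> ?B. U \<subseteq> V}"]) blast
qed simp

lemma small_boundary_at_imp_top_hausdorff_dim_le:
  assumes "K \<noteq> {}" "\<And>x. x \<in> K \<Longrightarrow> small_boundary_at K (d - 1) x"
  shows "top_hausdorff_dim K \<le> d"
  using assms(1) small_boundary_at_imp_basis[OF assms(2)]
  unfolding top_hausdorff_dim_def by (auto intro!: Inf_lower)

lemma top_hausdorff_dim_less_imp_small_boundary_at:
  assumes "top_hausdorff_dim K < d" "x \<in> K"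
  shows "\<exists>d'<d. small_boundary_at K (d' - 1) x"
proof -
  have "Inf {d. \<exists>\<B>. basis_of (top_of_set K) \<B> \<and>
      (\<forall>U\<in>\<B>. hausdorff_dim (top_of_set K frontier_of U) \<le> d - 1)} < d"
    using assms unfolding top_hausdorff_dim_def by (auto split: if_splits)
  then obtain d' \<B> where "d' < d" "basis_of (top_of_set K) \<B>"
      "\<forall>U\<in>\<B>. hausdorff_dim (top_of_set K frontier_of U) \<le> d' - 1"
    unfolding Inf_less_iff by blast
  then show ?thesis using basis_imp_small_boundary_at assms(2) by metis
qed

text \<open>Only the empty set has dimension below 0, so a value below 1 would give arbitrarily
  small clopen neighbourhoods, that is, small inductive dimension at most 0.\<close>

lemma one_le_top_hausdorff_dim:
  fixes K :: "'a::metric_space set"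
  assumes "small_ind_dim (top_of_set K) > 0" "K \<noteq> {}"
  shows "1 \<le> top_hausdorff_dim K"
proof (rule ccontr)
  assume "\<not> 1 \<le> top_hausdorff_dim K"
  then have less: "top_hausdorff_dim K < 1" by simp
  have "top_of_set K dim_le 0"
  proof (rule dimension_le.intros)
    fix V x assume V: "openin (top_of_set K) V" "x \<in> V"
    then have x: "x \<in> K" using openin_imp_subset by blast
    obtain r where r: "r > 0" "ball x r \<inter> K \<subseteq> V"
      using V unfolding openin_contains_ball by blast
    obtain d where d: "d < 1" "small_boundary_at K (d - 1) x"
      using top_hausdorff_dim_less_imp_small_boundary_at[OF less x] by blast
    then obtain U where U: "openin (top_of_set K) U" "x \<in> U" "U \<subseteq> ball x r"
        "hausdorff_dim (top_of_set K frontier_of U) \<le> d - 1"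
      using r(1) unfolding small_boundary_at_def by blast
    have "d - 1 < 0" using d(1) by (cases d) (auto simp: one_ereal_def)
    then have "top_of_set K frontier_of U = {}"
      using U(4) hausdorff_dim_nonneg[of "top_of_set K frontier_of U"] by force
    moreover have "U \<subseteq> V" using U r(2) openin_imp_subset by blast
    ultimately show "\<exists>U. x \<in> U \<and> U \<subseteq> V \<and> openin (top_of_set K) U \<and>
        subtopology (top_of_set K) (top_of_set K frontier_of U) dim_le 0 - 1"
      using U by (intro exI[of _ U]) simp
  qed simp
  then have "small_ind_dim (top_of_set K) \<le> ereal (of_int 0)"
    unfolding small_ind_dim_def by (intro Inf_lower) blast
  then show False using assms(1) by (simp add: zero_ereal_def)
qed

text \<open>A small ball around \<open>x0\<close> is enlarged by finitely many good neighbourhoods of the points of its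
  bounding sphere; only the boundaries of the latter survive.\<close>

lemma small_boundary_at_isolated:
  fixes K :: "'a::metric_space set"
  assumes K: "compact K" and s: "s \<ge> 0" and R: "R > 0"
    and near: "\<And>x. x \<in> K \<Longrightarrow> x \<in> ball x0 R \<Longrightarrow> x \<noteq> x0 \<Longrightarrow> small_boundary_at K (ereal s) x"
    and x0: "x0 \<in> K"
  shows "small_boundary_at K (ereal s) x0"
  unfolding small_boundary_at_def
proof (intro allI impI)
  fix r' :: real assume "r' > 0"
  \<comment> \<open>Capping by \<open>R\<close> keeps the sphere of radius \<open>r/2\<close> inside
    the punctured ball where \<open>near\<close> applies.\<close>
  define r where "r = min r' R"
  have r: "r > 0" "r \<le> r'" "r \<le> R" using R \<open>r' > 0\<close> by (auto simp: r_def)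
  let ?S = "K \<inter> sphere x0 (r/2)"
  have "closed (sphere x0 (r/2))"
    unfolding sphere_def by (intro closed_Collect_eq continuous_intros)
  then have "compact ?S" using K by (intro compact_Int_closed)
  have "\<exists>T. open T \<and> x \<in> T \<and> K \<inter> T \<subseteq> ball x (r/2) \<and> hausdorff_dim (top_of_set K frontier_of (K \<inter> T)) \<le> ereal s"
    if "x \<in> ?S" for x
    using near[of x] r that unfolding small_boundary_at_def openin_open 
    by (auto dest!: spec[of _ "r/2"]) blast
  then obtain T where T: "\<And>x. x \<in> ?S \<Longrightarrow> open (T x)" "\<And>x. x \<in> ?S \<Longrightarrow> x \<in> T x"
      "\<And>x. x \<in> ?S \<Longrightarrow> K \<inter> T x \<subseteq> ball x (r/2)"
      "\<And>x. x \<in> ?S \<Longrightarrow> hausdorff_dim (top_of_set K frontier_of (K \<inter> T x)) \<le> ereal s"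
    by metis
  obtain F where F: "F \<subseteq> ?S" "finite F" "?S \<subseteq> (\<Union>x\<in>F. T x)"
    by (rule compactE_image[OF \<open>compact ?S\<close>, of ?S T]) (use T in auto)
  define G where "G = ball x0 (r/2) \<union> (\<Union>x\<in>F. T x)"
  have "open G" 
    unfolding G_def by (intro open_Un open_UN ballI open_ball T(1)) (use F(1) in blast)
  then have oU: "openin (top_of_set K) (K \<inter> G)" by (rule openin_open_Int)
  have cl: "top_of_set K closure_of A = K \<inter> closure A" if "A \<subseteq> K" for A
    using that by (simp add: closure_of_subtopology Int_absorb1 Int_absorb2)
  \<comment> \<open>A boundary point of the enlarged set lies in the closure of one of finitely many
    pieces. It is not in the closure of the ball part, for then it would lie on the sphere, which
    the open sets \<open>T x\<close> cover.\<close>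
  have "top_of_set K frontier_of (K \<inter> G) \<subseteq> (\<Union>x\<in>F. top_of_set K frontier_of (K \<inter> T x))"
  proof
    fix z assume "z \<in> top_of_set K frontier_of (K \<inter> G)"
    then have z: "z \<in> K" "z \<in> closure (K \<inter> G)" "z \<notin> G"
      using oU by (auto simp: frontier_of_def interior_of_openin cl)
    have "closure (K \<inter> G) \<subseteq> closure (K \<inter> ball x0 (r/2)) \<union> (\<Union>x\<in>F. closure (K \<inter> T x))"
    proof (rule closure_minimal)
      show "K \<inter> G \<subseteq> closure (K \<inter> ball x0 (r/2)) \<union> (\<Union>x\<in>F. closure (K \<inter> T x))"
      proof
        fix w assume "w \<in> K \<inter> G"
        then have "w \<in> K \<inter> ball x0 (r/2) \<or> (\<exists>x\<in>F. w \<in> K \<inter> T x)" by (auto simp: G_def)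
        then show "w \<in> closure (K \<inter> ball x0 (r/2)) \<union> (\<Union>x\<in>F. closure (K \<inter> T x))"
          by (meson UN_I UnI1 UnI2 closure_subset subsetD)
      qed
    qed (use F(2) in \<open>intro closed_Un closed_UN ballI closed_closure\<close>)
    moreover have "z \<notin> closure (K \<inter> ball x0 (r/2))"
    proof
      assume zcl: "z \<in> closure (K \<inter> ball x0 (r/2))"
      have "closure (K \<inter> ball x0 (r/2)) \<subseteq> cball x0 (r/2)"
        by (rule closure_minimal) auto
      then have "z \<in> cball x0 (r/2)" using zcl by blast
      moreover have "z \<notin> ball x0 (r/2)" using z(3) by (simp add: G_def)
      ultimately have "z \<in> ?S" using z(1) by auto
      then show False using F(3) z(3) by (auto simp: G_def)
    qed
    ultimately obtain x where x: "x \<in> F" "z \<in> closure (K \<inter> T x)" using z(2) by blast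
    have "openin (top_of_set K) (K \<inter> T x)" using F(1) x(1) by (intro openin_open_Int T(1)) blast
    then have "z \<in> top_of_set K frontier_of (K \<inter> T x)"
      using x z by (simp add: frontier_of_def interior_of_openin cl G_def)
    then show "z \<in> (\<Union>x\<in>F. top_of_set K frontier_of (K \<inter> T x))" using x(1) by blast
  qed
  moreover have "hausdorff_dim (\<Union>x\<in>F. top_of_set K frontier_of (K \<inter> T x)) \<le> ereal s"
    by (intro hausdorff_dim_UN compact_frontier_of K T(4) F(2) s) (use F(1) in blast)
  moreover have "compact (\<Union>x\<in>F. top_of_set K frontier_of (K \<inter> T x))"
    using F(2) by (intro compact_UN compact_frontier_of K)
  ultimately have "hausdorff_dim (top_of_set K frontier_of (K \<inter> G)) \<le> ereal s"
    using hausdorff_dim_mono compact_frontier_of[OF K] s by blast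
  \<comment> \<open>Each added patch stays within \<open>r/2\<close> of a centre that is itself at
    distance \<open>r/2\<close> from \<open>x0\<close>.\<close>
  moreover have "K \<inter> G \<subseteq> ball x0 r'"
  proof
    fix z assume z: "z \<in> K \<inter> G"
    show "z \<in> ball x0 r'"
    proof (cases "z \<in> ball x0 (r/2)")
      case False
      then obtain x where x: "x \<in> F" "z \<in> T x" using z by (auto simp: G_def)
      then have xS: "x \<in> ?S" using F(1) by blast
      then have "z \<in> ball x (r/2)" using T(3)[of x] x z by blast
      then have "dist x z < r/2" by simp
      moreover have "dist x0 x = r/2" using xS by simp
      ultimately show ?thesis using r(2) dist_triangle[of x0 z x] by simp
    qed (use r in auto)
  qed
  moreover have "x0 \<in> K \<inter> G" using x0 r by (simp add: G_def)
  ultimately show "\<exists>U. openin (top_of_set K) U \<and> x0 \<in> U \<and> U \<subseteq> ball x0 r' \<and>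
      hausdorff_dim (top_of_set K frontier_of U) \<le> ereal s"
    using oU by blast
qed

text \<open>One point serves all \<open>s\<close> at once, so that a single fibre can later attain
  the maximum. Having \<open>x \<noteq> x0\<close> allows the values of a function near the two
  points to be moved independently.\<close>

lemma obtain_limit_of_large_boundary:
  fixes K :: "'a::metric_space set"
  assumes K: "compact K" "K \<noteq> {}"
  obtains x0 where "x0 \<in> K"
    "\<And>s r. 0 \<le> s \<Longrightarrow> ereal s < top_hausdorff_dim K - 1 \<Longrightarrow> r > 0 \<Longrightarrow>
       \<exists>x. x \<in> K \<and> x \<noteq> x0 \<and> dist x0 x < r \<and> \<not> small_boundary_at K (ereal s) x"
proof -
  define B where "B s = {x \<in> K. \<not> small_boundary_at K (ereal s) x}" for s
  define I where "I = {s. 0 \<le> s \<and> ereal s < top_hausdorff_dim K - 1}"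
  have "B s \<noteq> {}" if "s \<in> I" for s
  proof
    assume "B s = {}"
    then have "top_hausdorff_dim K \<le> ereal (s + 1)"
      using K(2) by (intro small_boundary_at_imp_top_hausdorff_dim_le) (auto simp: B_def one_ereal_def)
    moreover have "ereal s < top_hausdorff_dim K - 1" using that by (simp add: I_def)
    ultimately show False by (cases "top_hausdorff_dim K") (auto simp: one_ereal_def)
  qed
  moreover have "B t \<subseteq> B s" if "s \<le> t" for s t
    using that small_boundary_at_mono[of K "ereal s" _ "ereal t"] by (auto simp: B_def)
  ultimately have fip: "K \<inter> (\<Inter>s\<in>J. closure (B s)) \<noteq> {}" if "finite J" "J \<subseteq> I" for J
  proof (cases "J = {}")
    case False
    \<comment> \<open>The sets shrink as the parameter grows, so the largest parameter in
      \<open>J\<close> controls the intersection.\<close>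
    then have "Max J \<in> I" using that Max_in by blast
    then obtain x where "x \<in> B (Max J)" using \<open>\<And>s. s \<in> I \<Longrightarrow> B s \<noteq> {}\<close> by blast
    moreover have "B (Max J) \<subseteq> B s" if "s \<in> J" for s
      using \<open>finite J\<close> that \<open>\<And>t s. s \<le> t \<Longrightarrow> B t \<subseteq> B s\<close> by simp
    ultimately have "x \<in> K \<inter> (\<Inter>s\<in>J. closure (B s))"
      using closure_subset by (fastforce simp: B_def)
    then show ?thesis by blast
  qed (use K in simp)
  have "K \<inter> (\<Inter>s\<in>I. closure (B s)) \<noteq> {}"
    by (rule compact_imp_fip_image[OF K(1)]) (use fip in auto)
  then obtain x0 where x0: "x0 \<in> K" "\<And>s. s \<in> I \<Longrightarrow> x0 \<in> closure (B s)" by blast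
  show ?thesis
  proof
    show "x0 \<in> K" by fact
    fix s r :: real assume s: "0 \<le> s" "ereal s < top_hausdorff_dim K - 1" and r: "r > 0"
    have cl: "x0 \<in> closure (B s)" using x0(2) s by (simp add: I_def)
    show "\<exists>x. x \<in> K \<and> x \<noteq> x0 \<and> dist x0 x < r \<and> \<not> small_boundary_at K (ereal s) x"
    proof (rule ccontr)
      assume "\<nexists>x. x \<in> K \<and> x \<noteq> x0 \<and> dist x0 x < r \<and> \<not> small_boundary_at K (ereal s) x"
      then have *: "small_boundary_at K (ereal s) x" if "x \<in> K" "x \<in> ball x0 r" "x \<noteq> x0" for x
        using that by auto
      \<comment> \<open>All other points near \<open>x0\<close> being good, \<open>x0\<close> is
        good as well; then no point of \<open>B s\<close> is near \<open>x0\<close>, contrary to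
        \<open>cl\<close>.\<close>
      then have "small_boundary_at K (ereal s) x0"
        using small_boundary_at_isolated[OF K(1) s(1) r _ x0(1)] by blast
      moreover obtain x where "x \<in> B s" "dist x x0 < r"
        using cl r unfolding closure_approachable by blast
      ultimately show False using * by (cases "x = x0") (auto simp: B_def dist_commute)
    qed
  qed
qed

section \<open>Generic fibres are small\<close>

text \<open>An open interval is infinite, so the finitely many values already chosen can be
  avoided.\<close>

lemma obtain_injective_approximation:
  fixes v :: "'b \<Rightarrow> real"
  assumes "finite S" "\<eta> > 0"
  obtains c where "inj_on c S" "\<And>a. a \<in> S \<Longrightarrow> \<bar>c a - v a\<bar> < \<eta>"
proof -
  have "\<exists>c. inj_on c S \<and> (\<forall>a\<in>S. \<bar>c a - v a\<bar> < \<eta>)"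
    using assms(1)
  proof induction
    case (insert b S)
    then obtain c where c: "inj_on c S" "\<forall>a\<in>S. \<bar>c a - v a\<bar> < \<eta>" by blast
    have "infinite ({v b - \<eta><..<v b + \<eta>} - c ` S)"
      using assms(2) insert(1) by simp
    then obtain z where z: "z \<in> {v b - \<eta><..<v b + \<eta>}" "z \<notin> c ` S"
      by (metis DiffD1 DiffD2 ex_in_conv finite.emptyI)
    show ?case
      using c z insert(2) by (intro exI[of _ "c(b := z)"]) (auto simp: inj_on_def)
  qed simp
  then show ?thesis using that by blast
qed

lemma inj_on_finite_separated:
  fixes c :: "'b \<Rightarrow> real"
  assumes "finite S" "inj_on c S"
  obtains \<kappa> where "\<kappa> > 0" "\<And>a b. a \<in> S \<Longrightarrow> b \<in> S \<Longrightarrow> \<bar>c a - c b\<bar> < \<kappa> \<Longrightarrow> a = b"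
proof -
  let ?D = "(\<lambda>(a,b). \<bar>c a - c b\<bar>) ` {p \<in> S \<times> S. fst p \<noteq> snd p}"
  have fin: "finite ?D" using assms(1) by simp
  have pos: "\<forall>d\<in>?D. d > 0" using assms(2) by (auto simp: inj_on_def)
  show ?thesis
  proof
    \<comment> \<open>The extra 1 keeps the minimum meaningful when there are no two distinct
      points.\<close>
    show "Min (insert 1 ?D) > 0" using fin pos by simp
    fix a b assume "a \<in> S" "b \<in> S" "\<bar>c a - c b\<bar> < Min (insert 1 ?D)"
    then show "a = b"
      using fin by (fastforce simp: Min_less_iff not_less[symmetric])
  qed
qed

text \<open>The core of the upper bound. The estimate holds for every fibre of every
  \<open>g\<close> near \<open>f\<close>, which is the stability that nowhere density needs. Of the
  budget \<open>e\<close>, the set around the boundaries takes \<open>e/4\<close> and a single ball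
  the rest.\<close>

lemma fin_null_perturb:
  fixes K :: "'a::metric_space set" and f0 :: "'a \<Rightarrow> real"
  assumes K: "compact K" and t: "t > 0" and e: "e > 0" and \<eta>: "\<eta> > 0"
    and f0: "continuous_on K f0"
    and nbhd: "\<And>x r. x \<in> K \<Longrightarrow> r > 0 \<Longrightarrow>
      \<exists>U. openin (top_of_set K) U \<and> x \<in> U \<and> U \<subseteq> ball x r \<and> fin_null t (top_of_set K frontier_of U)"
  obtains f \<kappa> where "continuous_on K f" "\<kappa> > 0" "\<And>x. x \<in> K \<Longrightarrow> \<bar>f0 x - f x\<bar> \<le> \<eta>"
    "\<And>g y. (\<And>x. x \<in> K \<Longrightarrow> \<bar>f x - g x\<bar> < \<kappa>) \<Longrightarrow> small_cover t e {x \<in> K. g x = y}"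
proof -
  have "uniformly_continuous_on K f0"
    using f0 K by (rule compact_uniformly_continuous)
  then obtain \<rho> where \<rho>: "\<rho> > 0" "\<And>x x'. x \<in> K \<Longrightarrow> x' \<in> K \<Longrightarrow> dist x' x < \<rho> \<Longrightarrow> \<bar>f0 x' - f0 x\<bar> < \<eta>/2"
    unfolding uniformly_continuous_on_def using \<eta> by (metis dist_real_def half_gt_zero)
  \<comment> \<open>The first bound keeps the oscillation of \<open>f0\<close> on balls of radius
    \<open>r\<close> below \<open>\<eta>/2\<close>; the second makes the \<open>t\<close>-th power
    of their diameter at most \<open>e/2\<close>.\<close>
  define r where "r = min (\<rho>/2) ((e/2) powr (1/t) / 2)"
  have r: "r > 0" "2 * r \<le> \<rho>" using \<rho> e by (auto simp: r_def)
  have "(2 * r) powr t \<le> ((e/2) powr (1/t)) powr t"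
    using r t by (intro powr_mono2) (auto simp: r_def)
  also have "\<dots> = e/2" using t e by (simp add: powr_powr)
  finally have rt: "(2 * r) powr t \<le> e/2" .
  \<comment> \<open>The slack \<open>d\<close> is there because \<open>small_cover\<close> asks for
    a strict inequality.\<close>
  have ball_cover: "small_cover t (e/2 + d) (ball x r)" if "d > 0" for x :: 'a and d
  proof -
    have "diameter (ball x r) \<le> 2 * r"
    proof (rule diameter_le_dist)
      fix y z assume "y \<in> ball x r" "z \<in> ball x r"
      then show "dist y z \<le> 2 * r"
        using dist_triangle3[of y z x] by simp
    qed (use r in simp)
    then have "diameter (ball x r) powr t \<le> (2 * r) powr t"
      using t by (intro powr_mono2 diameter_ge_0) auto
    then show ?thesis
      unfolding small_cover_def using rt that by (intro exI[of _ "{ball x r}"]) auto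
  qed
  obtain T where T: "\<And>x. x \<in> K \<Longrightarrow> open (T x)" "\<And>x. x \<in> K \<Longrightarrow> x \<in> T x"
      "\<And>x. x \<in> K \<Longrightarrow> K \<inter> T x \<subseteq> ball x r" "\<And>x. x \<in> K \<Longrightarrow> fin_null t (top_of_set K frontier_of (K \<inter> T x))"
  proof -
    have "\<exists>T. open T \<and> x \<in> T \<and> K \<inter> T \<subseteq> ball x r \<and> fin_null t (top_of_set K frontier_of (K \<inter> T))" if "x \<in> K" for x
      using nbhd[OF that r(1)] unfolding openin_open by blast
    then show ?thesis using that by metis
  qed
  obtain F where F: "F \<subseteq> K" "finite F" "K \<subseteq> (\<Union>x\<in>F. T x)"
    by (rule compactE_image[OF K, of K T]) (use T in auto)
  define A where "A = (\<Union>x\<in>F. top_of_set K frontier_of (K \<inter> T x))"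
  have "fin_null t A"
    unfolding A_def using F(1,2) T(4) by (intro fin_null_UN) auto
  then have "small_cover t (e/4) A"
    using e unfolding fin_null_def by simp
  then obtain \<W> where \<W>: "finite \<W>" "\<forall>U\<in>\<W>. open U \<and> bounded U" "A \<subseteq> \<Union>\<W>" "(\<Sum>U\<in>\<W>. diameter U powr t) < e/4"
    unfolding small_cover_def by blast
  let ?W = "\<Union>\<W>"
  have W: "open ?W" "small_cover t (e/4) ?W"
    using \<W> unfolding small_cover_def by auto
  \<comment> \<open>\<open>a z\<close> codes the atom containing \<open>z\<close>; it is locally constant off \<open>\<Union>\<W>\<close>.\<close>
  define a where "a z = {x \<in> F. z \<in> T x}" for z
  have a_loc: "\<exists>G. open G \<and> z \<in> G \<and> (\<forall>z' \<in> G \<inter> (K - ?W). a z' = a z)" if z: "z \<in> K - ?W" for z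
  proof -
    \<comment> \<open>Off \<open>?W\<close> no boundary is met, so \<open>z\<close> lies either in
      the open set \<open>T x\<close> or outside the closure of \<open>K \<inter> T x\<close>; both
      alternatives are open conditions.\<close>
    define G where "G x = (if z \<in> T x then T x else - closure (K \<inter> T x))" for x
    have "open (\<Inter>x\<in>F. G x)" using F(1,2) T(1) by (intro open_INT ballI) (auto simp: G_def)
    moreover have "z \<in> G x" if "x \<in> F" for x
    proof (cases "z \<in> T x")
      case False
      have "z \<notin> top_of_set K frontier_of (K \<inter> T x)" using z that \<W>(3) by (auto simp: A_def)
      moreover have "openin (top_of_set K) (K \<inter> T x)" using T(1) F(1) that by (intro openin_open_Int) auto
      ultimately have "z \<notin> top_of_set K closure_of (K \<inter> T x)"
        using False by (auto simp: frontier_of_def interior_of_openin)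
      then show ?thesis using False z
        by (simp add: G_def closure_of_subtopology Int_absorb1 Int_absorb2)
    qed (simp add: G_def)
    moreover have "a z' = a z" if z': "z' \<in> (\<Inter>x\<in>F. G x) \<inter> (K - ?W)" for z'
    proof -
      have "z' \<in> T x \<longleftrightarrow> z \<in> T x" if "x \<in> F" for x
      proof -
        have "z' \<in> G x" "z' \<in> K" using z' that by auto
        then show ?thesis
          using closure_subset[of "K \<inter> T x"] by (auto simp: G_def split: if_splits)
      qed
      then show ?thesis unfolding a_def by blast
    qed
    ultimately show ?thesis by (intro exI[of _ "\<Inter>x\<in>F. G x"]) simp
  qed
  \<comment> \<open>Any \<open>x\<close> in the code of \<open>z\<close> confines all points with
    that code to \<open>ball x r\<close>.\<close>
  have a_ball: "\<exists>x\<in>F. \<forall>z' \<in> K. a z' = a z \<longrightarrow> z' \<in> ball x r" if z: "z \<in> K" for z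
  proof -
    obtain x where x: "x \<in> F" "z \<in> T x" using F(3) z by blast
    then have "x \<in> a z" by (simp add: a_def)
    then have "z' \<in> ball x r" if "z' \<in> K" "a z' = a z" for z'
      using T(3)[of x] F(1) x(1) that unfolding a_def by blast
    then show ?thesis using x(1) by blast
  qed
  \<comment> \<open>A value of \<open>f0\<close> on each atom; codes that belong to no point get an
    arbitrary value, and the estimate is only needed at codes \<open>a z\<close>.\<close>
  define v where "v s = f0 (SOME z. z \<in> K \<and> a z = s)" for s
  have v: "\<bar>v (a z) - f0 z\<bar> < \<eta>/2" if z: "z \<in> K" for z
  proof -
    let ?z = "SOME z'. z' \<in> K \<and> a z' = a z"
    have z': "?z \<in> K \<and> a ?z = a z" using z by (intro someI[of "\<lambda>z'. z' \<in> K \<and> a z' = a z"]) auto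
    obtain x where x: "\<forall>z' \<in> K. a z' = a z \<longrightarrow> z' \<in> ball x r" using a_ball[OF z] by blast
    then have "?z \<in> ball x r" "z \<in> ball x r" using z' z by blast+
    then have "dist ?z z < 2 * r"
      using dist_triangle3[of ?z z x] by simp
    then show ?thesis unfolding v_def using \<rho>(2)[of z ?z] z z' r by simp
  qed
  obtain c where c: "inj_on c (Pow F)" "\<And>s. s \<in> Pow F \<Longrightarrow> \<bar>c s - v s\<bar> < \<eta>/2"
    using obtain_injective_approximation[of "Pow F" "\<eta>/2" v] F \<eta> by auto
  obtain \<kappa> where \<kappa>: "\<kappa> > 0" "\<And>s s'. s \<in> Pow F \<Longrightarrow> s' \<in> Pow F \<Longrightarrow> \<bar>c s - c s'\<bar> < \<kappa> \<Longrightarrow> s = s'"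
    using inj_on_finite_separated[OF _ c(1)] F(2) by auto
  have aF: "a z \<in> Pow F" for z by (auto simp: a_def)
  have cont: "continuous_on (K - ?W) (\<lambda>z. c (a z))"
    unfolding continuous_on_def
  proof
    fix z assume "z \<in> K - ?W"
    then obtain G where "open G" "z \<in> G" "\<forall>z' \<in> G \<inter> (K - ?W). a z' = a z" using a_loc by blast
    then have "eventually (\<lambda>z'. c (a z') = c (a z)) (at z within K - ?W)"
      unfolding eventually_at_topological by (intro exI[of _ G]) auto
    then show "((\<lambda>z. c (a z)) \<longlongrightarrow> c (a z)) (at z within K - ?W)"
      by (rule tendsto_eventually)
  qed
  \<comment> \<open>Extending the difference from \<open>f0\<close>, rather than the new function
    itself, carries the bound \<open>\<eta>\<close> over to all of \<open>K\<close>. On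
    \<open>K - ?W\<close> this bound is the sum of two errors below \<open>\<eta>/2\<close>.\<close>
  have "normal_space (top_of_set K)"
    by (simp add: metrizable_imp_normal_space metrizable_space_euclidean metrizable_space_subtopology)
  moreover have "closedin (top_of_set K) (K - ?W)"
    unfolding Diff_eq using W(1) by (intro closedin_closed_Int) (rule closed_Compl)
  moreover have "continuous_map (subtopology (top_of_set K) (K - ?W)) euclideanreal (\<lambda>z. c (a z) - f0 z)"
    using cont continuous_on_subset[OF f0, of "K - ?W"]
    by (auto simp: subtopology_subtopology Int_absorb1 intro!: continuous_intros)
  moreover have "(\<lambda>z. c (a z) - f0 z) ` (K - ?W) \<subseteq> {-\<eta>..\<eta>}"
  proof clarify
    fix z assume "z \<in> K"
    then show "c (a z) - f0 z \<in> {-\<eta>..\<eta>}"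
      using v[of z] c(2)[OF aF[of z]] unfolding atLeastAtMost_iff by linarith
  qed
  moreover have "-\<eta> \<le> \<eta>" using \<eta> by simp
  ultimately obtain h where h: "continuous_map (top_of_set K) euclideanreal h"
      "\<And>z. z \<in> K - ?W \<Longrightarrow> h z = c (a z) - f0 z" "h ` topspace (top_of_set K) \<subseteq> {-\<eta>..\<eta>}"
    by (rule Tietze_extension_closed_real_interval) blast
  show ?thesis
  proof
    show "continuous_on K (\<lambda>z. f0 z + h z)"
      using f0 h(1) by (auto intro: continuous_intros)
    \<comment> \<open>With tolerance \<open>\<kappa>/2\<close>, two points off \<open>?W\<close> in
      one fibre of \<open>g\<close> have constants less than \<open>\<kappa>\<close> apart, hence
      the same code.\<close>
    show "\<kappa>/2 > 0" using \<kappa> by simp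
    show "\<bar>f0 x - (f0 x + h x)\<bar> \<le> \<eta>" if "x \<in> K" for x
      using h(3) that by (simp add: image_subset_iff) (metis abs_le_iff minus_le_iff)
    fix g y assume g: "\<And>x. x \<in> K \<Longrightarrow> \<bar>(f0 x + h x) - g x\<bar> < \<kappa>/2"
    let ?L = "{x \<in> K. g x = y}"
    show "small_cover t e ?L"
    proof (cases "?L \<subseteq> ?W")
      case True
      have "small_cover t (3*e/4) ({} :: 'a set)"
        using fin_null_empty[where 'a='a and t=t] e unfolding fin_null_def by simp
      then have "small_cover t (e/4 + 3*e/4) (?W \<union> {})"
        by (rule small_cover_Un[OF W(2)])
      then show ?thesis using True by (auto intro: small_cover_subset)
    next
      case False
      then obtain z where z: "z \<in> K" "g z = y" "z \<notin> ?W" by blast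
      obtain x where x: "\<forall>z' \<in> K. a z' = a z \<longrightarrow> z' \<in> ball x r" using a_ball[OF z(1)] by blast
      have "z' \<in> ball x r" if z': "z' \<in> K" "g z' = y" "z' \<notin> ?W" for z'
      proof -
        have "\<bar>c (a z') - c (a z)\<bar> < \<kappa>"
        proof -
          have "\<bar>c (a z) - y\<bar> < \<kappa>/2" "\<bar>c (a z') - y\<bar> < \<kappa>/2"
            using g[OF z(1)] g[OF z'(1)] z z' h(2)[of z] h(2)[of z'] by auto
          then show ?thesis by linarith
        qed
        then show ?thesis using \<kappa>(2)[OF aF aF] x z' by blast
      qed
      then have "?L \<subseteq> ?W \<union> ball x r" by blast
      moreover have "small_cover t (e/4 + (e/2 + e/4)) (?W \<union> ball x r)"
        using e by (intro small_cover_Un W(2) ball_cover) simp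
      moreover have "e/4 + (e/2 + e/4) = e" by simp
      ultimately show ?thesis by (metis small_cover_subset)
    qed
  qed
qed

text \<open>The strict inequality provides small neighbourhoods with boundary of dimension below
  \<open>t\<close>, which are therefore \<open>t\<close>-null, as \<open>fin_null_perturb\<close>
  requires.\<close>

lemma nowhere_dense_large_fibre:
  fixes K :: "'a::metric_space set"
  assumes K: "compact K" "K \<noteq> {}" and t: "t > 0" "top_hausdorff_dim K < ereal (t + 1)" and e: "e > 0"
  shows "nowhere_dense_in (mtopology_of (C_space K))
    {f \<in> mspace (C_space K). \<exists>y. \<not> small_cover t e {x \<in> K. f x = y}}" (is "nowhere_dense_in _ ?N")
proof (rule nowhere_dense_in_C_space[OF K])
  have nbhd: "\<exists>U. openin (top_of_set K) U \<and> x \<in> U \<and> U \<subseteq> ball x r \<and> fin_null t (top_of_set K frontier_of U)"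
    if x: "x \<in> K" and r: "r > 0" for x r
  proof -
    obtain d where d: "d < ereal (t + 1)" "small_boundary_at K (d - 1) x"
      using top_hausdorff_dim_less_imp_small_boundary_at[OF t(2) x] by blast
    have "d - 1 < ereal t" using d(1) by (cases d) (auto simp: one_ereal_def)
    moreover obtain U where "openin (top_of_set K) U" "x \<in> U" "U \<subseteq> ball x r"
        "hausdorff_dim (top_of_set K frontier_of U) \<le> d - 1"
      using d(2) r unfolding small_boundary_at_def by blast
    ultimately show ?thesis
      using hausdorff_dim_less_imp_fin_null[OF _ compact_frontier_of[OF K(1)]] by (meson le_less_trans)
  qed
  fix f0 :: "'a \<Rightarrow> real" and r :: real assume "continuous_on K f0" "r > 0"
  then obtain f \<kappa> where f: "continuous_on K f" "\<kappa> > 0" "\<And>x. x \<in> K \<Longrightarrow> \<bar>f0 x - f x\<bar> \<le> r"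
    "\<And>g y. (\<And>x. x \<in> K \<Longrightarrow> \<bar>f x - g x\<bar> < \<kappa>) \<Longrightarrow> small_cover t e {x \<in> K. g x = y}"
    using fin_null_perturb[OF K(1) t(1) e _ _ nbhd] by blast
  have "\<exists>x\<in>K. \<bar>f x - g x\<bar> \<ge> \<kappa>" if "g \<in> ?N" for g
    using f(4)[of g] that by (force simp: not_le[symmetric])
  then show "\<exists>f \<kappa>. continuous_on K f \<and> \<kappa> > 0 \<and> (\<forall>x\<in>K. \<bar>f0 x - f x\<bar> \<le> r) \<and>
            (\<forall>g\<in>?N. \<exists>x\<in>K. \<bar>f x - g x\<bar> \<ge> \<kappa>)"
    using f by blast
qed auto

section \<open>Generic fibres are large\<close>

text \<open>The ring where \<open>f > c\<close> separates the part of the sublevel set near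
  \<open>x1\<close> from the sphere, so cutting with the ball creates no new boundary.\<close>

lemma carve_neighbourhood:
  fixes K :: "'a::metric_space set" and f :: "'a \<Rightarrow> real"
  assumes f: "continuous_on K f" and \<rho>: "\<rho> > 0" and x1: "x1 \<in> K" "f x1 < c"
    and ring: "\<And>z. z \<in> K \<Longrightarrow> \<rho>/2 \<le> dist x1 z \<Longrightarrow> dist x1 z \<le> \<rho> \<Longrightarrow> f z > c"
  obtains U where "openin (top_of_set K) U" "x1 \<in> U" "U \<subseteq> ball x1 \<rho>"
    "top_of_set K frontier_of U \<subseteq> {z \<in> K. f z = c}"
proof
  define U where "U = {z \<in> K. f z < c} \<inter> ball x1 \<rho>"
  have "openin (top_of_set K) {z \<in> K. f z < c}"
    using continuous_openin_preimage_gen[OF f, of "{..<c}"] by (simp add: vimage_def Collect_conj_eq)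
  then show oU: "openin (top_of_set K) U"
    unfolding U_def by (intro openin_Int_open) auto
  show "x1 \<in> U" "U \<subseteq> ball x1 \<rho>" using x1 \<rho> by (auto simp: U_def)
  show "top_of_set K frontier_of U \<subseteq> {z \<in> K. f z = c}"
  proof
    fix z assume "z \<in> top_of_set K frontier_of U"
    then have z: "z \<in> K" "z \<in> top_of_set K closure_of U" "z \<notin> U"
      using oU by (auto simp: frontier_of_def interior_of_openin closure_of_subtopology)
    have "closedin (top_of_set K) ({z \<in> K. f z \<le> c} \<inter> (K \<inter> cball x1 \<rho>))"
    proof (rule closedin_Int)
      show "closedin (top_of_set K) {z \<in> K. f z \<le> c}"
        using continuous_closedin_preimage[OF f, of "{..c}"] by (simp add: vimage_def Collect_conj_eq)
    qed (simp add: closedin_closed_Int)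
    moreover have "U \<subseteq> {z \<in> K. f z \<le> c} \<inter> (K \<inter> cball x1 \<rho>)" by (auto simp: U_def)
    ultimately have "z \<in> {z \<in> K. f z \<le> c} \<inter> (K \<inter> cball x1 \<rho>)"
      using z(2) closure_of_minimal by (metis subsetD)
    \<comment> \<open>Here \<open>f z \<le> c\<close> keeps \<open>z\<close> out of the ring, hence
      inside the ball; as \<open>z\<close> is not in \<open>U\<close>, also
      \<open>f z \<ge> c\<close>.\<close>
    then show "z \<in> {z \<in> K. f z = c}"
      using z ring[of z] by (force simp: U_def)
  qed
qed

text \<open>The fibre is fixed by a point instead of a value, so its level moves along with the
  function. For all functions near the perturbed one, it contains the boundary of a small
  neighbourhood of a bad point, and such a boundary has dimension above \<open>s\<close>.\<close>

lemma nowhere_dense_low_dim_fibre: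
  fixes K :: "'a::metric_space set"
  assumes K: "compact K" and x0: "x0 \<in> K" and s: "0 \<le> s"
    and bad: "\<And>r. r > 0 \<Longrightarrow> \<exists>x. x \<in> K \<and> x \<noteq> x0 \<and> dist x0 x < r \<and> \<not> small_boundary_at K (ereal s) x"
  shows "nowhere_dense_in (mtopology_of (C_space K))
    {f \<in> mspace (C_space K). hausdorff_dim {x \<in> K. f x = f x0} \<le> ereal s}" (is "nowhere_dense_in _ ?N")
proof (rule nowhere_dense_in_C_space[OF K])
  fix f0 :: "'a \<Rightarrow> real" and r :: real assume f0: "continuous_on K f0" and r: "r > 0"
  \<comment> \<open>The two drops add up to at most \<open>3 * \<delta> + 3/2 * \<delta>\<close>,
    which is less than \<open>5 * \<delta> = r\<close>.\<close>
  define \<delta> where "\<delta> = r/5"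
  have \<delta>: "\<delta> > 0" using r by (simp add: \<delta>_def)
  obtain R where R: "R > 0" "\<And>x. x \<in> K \<Longrightarrow> dist x x0 < R \<Longrightarrow> \<bar>f0 x - f0 x0\<bar> < \<delta>"
    using f0 x0 \<delta> unfolding continuous_on_iff by (metis dist_real_def)
  obtain x1 where x1: "x1 \<in> K" "x1 \<noteq> x0" "dist x0 x1 < R/2" "\<not> small_boundary_at K (ereal s) x1"
    using bad[of "R/2"] R(1) by auto
  obtain \<rho>' where \<rho>': "\<rho>' > 0" 
      "\<And>U. openin (top_of_set K) U \<Longrightarrow> x1 \<in> U \<Longrightarrow> U \<subseteq> ball x1 \<rho>' \<Longrightarrow>
          \<not> hausdorff_dim (top_of_set K frontier_of U) \<le> ereal s"
    using x1(4) unfolding small_boundary_at_def by blast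
  \<comment> \<open>The scale \<open>\<rho>'\<close> witnesses that \<open>x1\<close> is bad;
    \<open>R/2\<close> keeps the ring within distance \<open>R\<close> of \<open>x0\<close>; the
    last bound keeps the ring at distance at least \<open>\<rho>\<close> from \<open>x0\<close>,
    beyond the bump there.\<close>
  define \<rho> where "\<rho> = min \<rho>' (min (R/2) (dist x0 x1 / 2))"
  have \<rho>: "\<rho> > 0" "\<rho> \<le> \<rho>'" "\<rho> \<le> R/2" "2 * \<rho> \<le> dist x0 x1"
    using \<rho>' R x1 by (auto simp: \<rho>_def)
  \<comment> \<open>The value at \<open>x1\<close> drops by \<open>3\<delta>\<close>, the value at \<open>x0\<close> by \<open>3\<delta>/2\<close>, and the ring around \<open>x1\<close> stays
    above both, since \<open>f0\<close> oscillates by less than \<open>\<delta>\<close>.\<close>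
  define f where "f z = f0 z - 3 * \<delta> * max 0 (1 - dist x1 z / (\<rho>/2)) - 3/2 * \<delta> * max 0 (1 - dist x0 z / \<rho>)" for z
  have "continuous_on K f"
    unfolding f_def using f0 \<rho>(1) by (intro continuous_intros) auto
  show "\<exists>f \<kappa>. continuous_on K f \<and> \<kappa> > 0 \<and> (\<forall>x\<in>K. \<bar>f0 x - f x\<bar> \<le> r) \<and>
            (\<forall>g\<in>?N. \<exists>x\<in>K. \<bar>f x - g x\<bar> \<ge> \<kappa>)"
  proof (intro exI conjI ballI)
    show "continuous_on K f" by fact
    \<comment> \<open>The value at \<open>x0\<close> differs from that at \<open>x1\<close> and from
      those on the ring by more than \<open>\<delta>/2\<close>, so errors below
      \<open>\<delta>/4\<close> preserve the order.\<close>
    show "\<delta>/4 > 0" using \<delta> by simp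
    show "\<bar>f0 x - f x\<bar> \<le> r" for x
    proof -
      have *: "0 \<le> max 0 (1 - dist y z / w) \<and> max 0 (1 - dist y z / w) \<le> 1" if "w > 0" for y z :: 'a and w
        using that by simp
      have "3 * \<delta> * max 0 (1 - dist x1 x / (\<rho>/2)) \<le> 3 * \<delta> * 1"
           "3/2 * \<delta> * max 0 (1 - dist x0 x / \<rho>) \<le> 3/2 * \<delta> * 1"
        using \<delta> \<rho>(1) *[of "\<rho>/2" x1 x] *[of \<rho> x0 x] by (intro mult_left_mono; simp)+
      moreover have "0 \<le> 3 * \<delta> * max 0 (1 - dist x1 x / (\<rho>/2))"
           "0 \<le> 3/2 * \<delta> * max 0 (1 - dist x0 x / \<rho>)"
        using \<delta> by simp_all
      ultimately show ?thesis using \<delta> unfolding f_def \<delta>_def by linarith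
    qed
    fix g assume g: "g \<in> ?N"
    show "\<exists>x\<in>K. \<bar>f x - g x\<bar> \<ge> \<delta>/4"
    proof (rule ccontr)
      assume "\<not> (\<exists>x\<in>K. \<bar>f x - g x\<bar> \<ge> \<delta>/4)"
      then have close: "\<bar>f x - g x\<bar> < \<delta>/4" if "x \<in> K" for x using that by force
      have contg: "continuous_on K g" using g K by (simp add: mspace_C_space)
      have bump0: "max 0 (1 - dist y z / w) = 0" if "w > 0" "w \<le> dist y z" for y z :: 'a and w
        using that by simp
      have fx0: "f x0 = f0 x0 - 3/2 * \<delta>"
        using bump0[of "\<rho>/2" x1 x0] \<rho> by (simp add: f_def dist_commute)
      have "f x1 = f0 x1 - 3 * \<delta>"
        using bump0[of "\<rho>" x0 x1] \<rho> by (simp add: f_def)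
      then have fx1: "f x1 < f0 x0 - 2 * \<delta>"
        using R(2)[of x1] x1 R(1) by (simp add: dist_commute abs_less_iff)
      have ring: "g z > g x0" if z: "z \<in> K" "\<rho>/2 \<le> dist x1 z" "dist x1 z \<le> \<rho>" for z
      proof -
        have "dist x0 x1 \<le> dist x0 z + dist x1 z" by (metis dist_commute dist_triangle)
        then have "\<rho> \<le> dist x0 z" using z \<rho> by linarith
        then have "f z = f0 z"
          using bump0[of "\<rho>/2" x1 z] bump0[of \<rho> x0 z] z \<rho>(1) by (simp add: f_def)
        moreover have "dist z x0 < R"
          using dist_triangle[of x0 z x1] x1(3) z(3) \<rho>(3) by (simp add: dist_commute)
        then have "f0 z > f0 x0 - \<delta>" using R(2)[OF z(1)] by linarith
        ultimately show ?thesis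
          using fx0 close[OF x0] close[OF z(1)] by linarith
      qed
      have "g x1 < g x0"
        using fx0 fx1 close[OF x0] close[OF x1(1)] by linarith
      then obtain U where U: "openin (top_of_set K) U" "x1 \<in> U" "U \<subseteq> ball x1 \<rho>"
          "top_of_set K frontier_of U \<subseteq> {z \<in> K. g z = g x0}"
        using carve_neighbourhood[OF contg \<rho>(1) x1(1) _ ring] by blast
      have "hausdorff_dim (top_of_set K frontier_of U) \<le> ereal s"
      proof (rule hausdorff_dim_mono[OF U(4)])
        show "compact {z \<in> K. g z = g x0}" using compact_fibre[OF K contg] .
      qed (use g s compact_frontier_of[OF K] in auto)
      moreover have "U \<subseteq> ball x1 \<rho>'" using U(3) \<rho>(2) by auto
      ultimately show False using \<rho>'(2) U by blast
    qed
  qed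
qed (use x0 in auto)

section \<open>Assembly of countably many exceptional sets\<close>

theorem theorem4p1:
  fixes K :: "'a::metric_space set"
  assumes "compact K"
    and "small_ind_dim (top_of_set K) > 0"
  shows "comeager_in (mtopology_of (C_space K))
           {f \<in> mspace (C_space K).
              (\<exists>y::real. hausdorff_dim {x \<in> K. f x = y} = top_hausdorff_dim K - 1) \<and>
              (\<forall>y::real. hausdorff_dim {x \<in> K. f x = y} \<le> top_hausdorff_dim K - 1)}"
proof -
  note K = assms(1)
  have ne: "K \<noteq> {}"
  proof
    assume "K = {}"
    then have "top_of_set K = trivial_topology" by simp
    then show False using assms(2) small_ind_dim_empty[where 'a='a] by simp
  qed
  define D where "D = top_hausdorff_dim K"
  have D: "1 \<le> D" unfolding D_def using one_le_top_hausdorff_dim[OF assms(2) ne] .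
  obtain x0 where x0: "x0 \<in> K"
    "\<And>s r. 0 \<le> s \<Longrightarrow> ereal s < D - 1 \<Longrightarrow> r > 0 \<Longrightarrow>
       \<exists>x. x \<in> K \<and> x \<noteq> x0 \<and> dist x0 x < r \<and> \<not> small_boundary_at K (ereal s) x"
    unfolding D_def using obtain_limit_of_large_boundary[OF K ne] by blast
  define L where "L s = {f \<in> mspace (C_space K). hausdorff_dim {x \<in> K. f x = f x0} \<le> ereal s}" for s
  define H where "H t e = {f \<in> mspace (C_space K). \<exists>y. \<not> small_cover t e {x \<in> K. f x = y}}" for t e
  \<comment> \<open>Rational exponents and tolerances \<open>1 / Suc n\<close> make the exceptional
    family countable. For \<open>D = \<infinity>\<close> the index set \<open>?J\<close> is empty,
    for \<open>D = 1\<close> the index set \<open>?I\<close> is.\<close>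
  let ?I = "{q::rat. 0 \<le> real_of_rat q \<and> ereal (real_of_rat q) < D - 1}"
  let ?J = "{p::rat \<times> nat. 0 < real_of_rat (fst p) \<and> D < ereal (real_of_rat (fst p) + 1)}"
  let ?F = "(\<lambda>q. L (real_of_rat q)) ` ?I \<union> (\<lambda>p. H (real_of_rat (fst p)) (1 / Suc (snd p))) ` ?J"
  have upper: "hausdorff_dim {x \<in> K. f x = y} \<le> D - 1" if f: "f \<in> mspace (C_space K)" "f \<notin> \<Union>?F" for f y
  proof (cases D)
    case (real d)
    let ?A = "{x \<in> K. f x = y}"
    have d1: "1 \<le> d" using D real by (simp add: one_ereal_def)
    have A: "compact ?A" using compact_fibre[OF K] f(1) K by (simp add: mspace_C_space)
    have "fin_null t ?A" if t: "d - 1 < t" for t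
    proof -
      \<comment> \<open>Only rational exponents are controlled, so nullity is shown at some
        \<open>q < t\<close> and then raised to \<open>t\<close>.\<close>
      obtain q where q: "d - 1 < real_of_rat q" "real_of_rat q < t" using of_rat_dense[OF t] by blast
      have q0: "0 < real_of_rat q" using d1 q(1) by linarith
      have "small_cover (real_of_rat q) \<epsilon> ?A" if pos: "\<epsilon> > 0" for \<epsilon>
      proof -
        obtain n where n: "1 / Suc n < \<epsilon>" using nat_approx_posE[OF pos] by blast
        have "(q, n) \<in> ?J" using q q0 real by simp
        then have "f \<notin> H (real_of_rat q) (1 / Suc n)" using f(2) by fastforce
        then have "small_cover (real_of_rat q) (1 / Suc n) ?A" using f(1) by (simp add: H_def)
        then show ?thesis using n unfolding small_cover_def by (meson less_trans)
      qed
      then have "fin_null (real_of_rat q) ?A" by (simp add: fin_null_def)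
      then show ?thesis using q0 q(2) by (simp add: fin_null_mono)
    qed
    then have "hausdorff_dim ?A \<le> ereal (d - 1)"
      using d1 by (simp add: hausdorff_dim_le_iff[OF A])
    then show ?thesis using real by (simp add: one_ereal_def)
  qed (use D in auto)
  have lower: "D - 1 \<le> hausdorff_dim {x \<in> K. f x = f x0}" if f: "f \<in> mspace (C_space K)" "f \<notin> \<Union>?F" for f
  proof (rule ccontr)
    let ?A = "{x \<in> K. f x = f x0}"
    assume "\<not> D - 1 \<le> hausdorff_dim ?A"
    then have "hausdorff_dim ?A < D - 1" by simp
    then obtain q :: rat where q: "hausdorff_dim ?A < ereal (real_of_rat q)" "ereal (real_of_rat q) < D - 1"
      using ereal_dense3 by blast
    \<comment> \<open>The fibre contains \<open>x0\<close>, so its dimension is nonnegative; this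
      puts \<open>q\<close> into \<open>?I\<close>.\<close>
    have "?A \<noteq> {}" using x0(1) by blast
    then have "0 \<le> hausdorff_dim ?A" by (rule hausdorff_dim_nonneg)
    then have "0 < ereal (real_of_rat q)" using q(1) by (rule le_less_trans)
    then have "q \<in> ?I" using q(2) by simp
    moreover have "f \<in> L (real_of_rat q)" using f(1) q(1) by (simp add: L_def)
    ultimately show False using f(2) by blast
  qed
  show ?thesis
    unfolding D_def[symmetric]
  proof (rule comeager_in_superset[of ?F])
    show "countable ?F" by (intro countable_Un countable_image) auto
    show "nowhere_dense_in (mtopology_of (C_space K)) N" if "N \<in> ?F" for N
      using that
    proof (elim UnE imageE)
      fix q assume "N = L (real_of_rat q)" "q \<in> ?I"
      then show ?thesis
        unfolding L_def using x0 by (auto intro!: nowhere_dense_low_dim_fibre[OF K x0(1)])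
    next
      fix p assume "N = H (real_of_rat (fst p)) (1 / Suc (snd p))" "p \<in> ?J"
      then show ?thesis
        unfolding H_def D_def using nowhere_dense_large_fibre[OF K ne] by simp
    qed
    show "topspace (mtopology_of (C_space K)) - \<Union>?F \<subseteq> {f \<in> mspace (C_space K).
              (\<exists>y::real. hausdorff_dim {x \<in> K. f x = y} = D - 1) \<and>
              (\<forall>y::real. hausdorff_dim {x \<in> K. f x = y} \<le> D - 1)}"
    proof
      fix f assume "f \<in> topspace (mtopology_of (C_space K)) - \<Union>?F"
      then have f: "f \<in> mspace (C_space K)" "f \<notin> \<Union>?F" by simp_all
      have "hausdorff_dim {x \<in> K. f x = f x0} = D - 1"
        using upper[OF f] lower[OF f] by (rule antisym)
      then show "f \<in> {f \<in> mspace (C_space K).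
              (\<exists>y::real. hausdorff_dim {x \<in> K. f x = y} = D - 1) \<and>
              (\<forall>y::real. hausdorff_dim {x \<in> K. f x = y} \<le> D - 1)}"
        using f upper[OF f] by blast
    qed
  qed auto
qed

end
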